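(* Let $i>0$ be an integer. Then the following three statements are equivalent: (1) $g(2,2^{i}) \neq 2$; (2) $i+1$ is a Mersenne exponent; (3) $\frac{g(2,2^{i})}{2} = 2^{i+1}-1$ and this number is a Mersenne prime.
   Context: For an integer $n>1$, $g(2,n)$ denotes the greatest common divisor of the set of binomial coefficients $\left\{\binom{2n}{2k}: 1\leq k<n\right\}$, $k$ ranging over integers. If $2^j-1$ is prime, then $j$ is called a Mersenne exponent and $2^j-1$ is called a Mersenne prime. *)

theory Defs
  imports Complex_Main "HOL-Computational_Algebra.Primes"
begin

definition g2 :: "nat \<Rightarrow> nat" where
  "g2 n = Gcd {(2 * n) choose (2 * k) | k. 1 \<le> k \<and> k < n}"

definition mersenne_exponent :: "nat \<Rightarrow> bool" where
  "mersenne_exponent j \<longleftrightarrow> prime (2 ^ j - 1 :: nat)"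

definition mersenne_prime :: "nat \<Rightarrow> bool" where
  "mersenne_prime p \<longleftrightarrow> (\<exists>j. p = 2 ^ j - 1 \<and> prime p)"

end

theory Submission
  imports Defs
begin

text \<open>
  Write \<open>N = 2 ^ m\<close> with \<open>m = i + 1\<close>, so that \<open>g\<close> is the gcd of the binomial coefficients
  \<open>N choose j\<close> with \<open>j\<close> even and \<open>0 < j < N\<close>. Since \<open>N\<close> is a power of \<open>2\<close>, each of them is
  even, and the central one, twice an odd number, is not divisible by \<open>4\<close>. Hence \<open>g = 2 * h\<close> with
  \<open>h\<close> odd. The coefficient at \<open>j = 2\<close> is \<open>2 ^ i * (N - 1)\<close>, so \<open>h\<close> divides \<open>N - 1\<close>.

  Let \<open>p\<close> be an odd prime factor of \<open>g\<close> and \<open>N - 1 = p ^ a * u\<close> with \<open>u\<close> prime to \<open>p\<close>. Then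
  \<open>a > 0\<close>, and the coefficient at the even index \<open>p ^ a + 1\<close> is prime to \<open>p\<close>
  (\<open>not_dvd_binomial_multiple_plus_1\<close>; in base \<open>p\<close> the digits of this index nowhere exceed those of
  \<open>N\<close>). So this index cannot lie below \<open>N\<close>, which means \<open>N - 1 = p ^ a\<close>. A Mersenne number is never
  a proper power of a prime (\<open>mersenne_prime_power\<close>), so \<open>N - 1 = p\<close>.

  Thus if \<open>g\<close> is not \<open>2\<close>, then \<open>N - 1\<close> is a prime and \<open>h\<close>, a divisor of it other than \<open>1\<close>, equals
  it. Conversely, if \<open>N - 1\<close> is prime, Pascal's rule shows that it divides every \<open>N choose j\<close> with
  \<open>1 < j < N - 1\<close>, so it divides \<open>g\<close>, which is therefore not \<open>2\<close>.
\<close>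

section \<open>Binomial coefficients modulo a prime\<close>

text \<open>By absorption \<open>p ^ a\<close> divides \<open>j\<close> times the coefficient, while it does not divide \<open>j\<close>.\<close>

lemma prime_dvd_binomial_prime_power_multiple:
  fixes p :: nat
  assumes "prime p" "0 < j" "j < p ^ a"
  shows "p dvd (p ^ a * u choose j)"
proof (rule ccontr)
  assume "\<not> p dvd (p ^ a * u choose j)"
  then have "coprime (p ^ a) (p ^ a * u choose j)"
    using assms(1) by (simp add: prime_imp_coprime)
  moreover have "p ^ a dvd j * (p ^ a * u choose j)"
    using times_binomial_minus1_eq[OF assms(2), of "p ^ a * u"] by simp
  ultimately have "p ^ a dvd j"
    by (simp add: coprime_dvd_mult_left_iff)
  then show False
    using assms(2,3) by (simp add: nat_dvd_not_less)
qed

text \<open>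
  In the row just before a multiple of \<open>p ^ a\<close>, any two neighbours among the first \<open>p ^ a\<close> entries
  add up to a multiple of \<open>p\<close>; the entries are thus \<open>1, -1, 1, \<dots>\<close> modulo \<open>p\<close>.
\<close>

lemma not_dvd_binomial_prime_power_multiple_minus_1:
  fixes p :: nat
  assumes "prime p" "0 < u" "j < p ^ a"
  shows "\<not> p dvd (p ^ a * u - 1 choose j)"
  using assms(3)
proof (induction j)
  case 0
  then show ?case using prime_gt_1_nat[OF assms(1)] by simp
next
  case (Suc j)
  have "Suc (p ^ a * u - 1) = p ^ a * u"
    using assms(2) prime_gt_0_nat[OF assms(1)] by simp
  then have "(p ^ a * u choose Suc j) = (p ^ a * u - 1 choose j) + (p ^ a * u - 1 choose Suc j)"
    by (metis binomial_Suc_Suc)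
  moreover have "p dvd (p ^ a * u choose Suc j)"
    using prime_dvd_binomial_prime_power_multiple[OF assms(1)] Suc.prems by simp
  ultimately show ?case
    using Suc by (metis Suc_lessD dvd_add_left_iff)
qed

text \<open>
  Two absorptions turn \<open>(p ^ a + 1) * (p ^ a * u + 1 choose p ^ a + 1)\<close> into
  \<open>(p ^ a * u + 1) * u\<close> times an entry of the row before \<open>p ^ a * u\<close>.
\<close>

lemma not_dvd_binomial_multiple_plus_1:
  fixes p :: nat
  assumes "prime p" "0 < a" "\<not> p dvd u"
  shows "\<not> p dvd (p ^ a * u + 1 choose (p ^ a + 1))"
proof
  assume dvd: "p dvd (p ^ a * u + 1 choose (p ^ a + 1))"
  have pos: "p ^ a > 0" "u > 0"
    using assms prime_gt_0_nat[OF assms(1)] by (auto intro: ccontr)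
  have "p ^ a * (p ^ a * u choose p ^ a) = p ^ a * u * (p ^ a * u - 1 choose (p ^ a - 1))"
    using times_binomial_minus1_eq[OF pos(1)] .
  then have inner: "(p ^ a * u choose p ^ a) = u * (p ^ a * u - 1 choose (p ^ a - 1))"
    using pos(1) by (metis mult.assoc mult_cancel1 less_not_refl)
  have "(p ^ a + 1) * (p ^ a * u + 1 choose (p ^ a + 1)) =
      (p ^ a * u + 1) * (p ^ a * u choose p ^ a)"
    using times_binomial_minus1_eq[of "p ^ a + 1" "p ^ a * u + 1"] by simp
  then have "p dvd (p ^ a * u + 1) * (u * (p ^ a * u - 1 choose (p ^ a - 1)))"
    using dvd inner by (metis dvd_mult)
  moreover have "\<not> p dvd p ^ a * u + 1"
  proof -
    have "p dvd p ^ a * u" using assms(2) by simp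
    moreover have "\<not> p dvd 1" using prime_gt_1_nat[OF assms(1)] by simp
    ultimately show ?thesis by (metis dvd_add_right_iff)
  qed
  moreover have "\<not> p dvd (p ^ a * u - 1 choose (p ^ a - 1))"
    using not_dvd_binomial_prime_power_multiple_minus_1[OF assms(1) pos(2)] pos(1) by simp
  ultimately show False
    using assms(1,3) by (metis prime_dvd_mult_iff)
qed

text \<open>In Pascal's rule for row \<open>p + 1\<close> both summands are inner entries of row \<open>p\<close>.\<close>

lemma prime_dvd_binomial_Suc_prime:
  fixes p :: nat
  assumes "prime p" "1 < j" "j < p"
  shows "p dvd (Suc p choose j)"
proof -
  obtain k where k: "j = Suc k" "0 < k" "k < p" using assms by (cases j) auto
  have "p dvd (p choose k)" "p dvd (p choose Suc k)"
    using prime_dvd_binomial_prime_power_multiple[OF assms(1), of _ 1 1] k assms by simp_all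
  then show ?thesis using k by simp
qed

section \<open>Prime powers below a power of 2\<close>

text \<open>
  The power \<open>p ^ a\<close> is \<open>3\<close> modulo \<open>4\<close> and hence no square, so \<open>a\<close> is odd. Then \<open>p + 1\<close>
  divides \<open>p ^ a + 1\<close>, so it is a power of \<open>2\<close>; and \<open>p ^ a + 1\<close> exceeds it by a multiple of
  \<open>2 * (p + 1)\<close>, so \<open>p ^ a + 1\<close> is not a higher power of \<open>2\<close> than \<open>p + 1\<close>.
\<close>

lemma mersenne_prime_power:
  fixes p :: nat
  assumes "odd p" "2 \<le> m" "p ^ a + 1 = 2 ^ m"
  shows "p = 2 ^ m - 1"
proof -
  have four: "(4::nat) dvd p ^ a + 1"
    using le_imp_power_dvd[OF assms(2), of "2::nat"] assms(3) by simp
  have "odd a"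
  proof
    assume "even a"
    then obtain b where "a = 2 * b" by (elim evenE)
    then have sq: "p ^ a = (p ^ b)\<^sup>2" by (simp add: power_mult mult.commute)
    obtain c where "p ^ b = 2 * c + 1" using assms(1) by (metis even_power oddE)
    then have "p ^ a + 1 = 4 * (c\<^sup>2 + c) + 2"
      using sq by (simp add: power2_eq_square algebra_simps)
    then show False using four by presburger
  qed
  then obtain b where a: "a = 2 * b + 1" by (elim oddE)
  obtain d where d: "p = 2 * d + 1" using assms(1) by (elim oddE)
  have "int p ^ 2 - 1 dvd (int p ^ 2) ^ b - 1 ^ b"
    by (metis dvd_triv_left power_diff_sumr2)
  moreover have "int p ^ 2 - 1 = 2 * (int p + 1) * int d"
    using d by (simp add: power2_eq_square algebra_simps)
  ultimately have "2 * (int p + 1) dvd (int p ^ 2) ^ b - 1"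
    by (metis dvd_mult_left power_one)
  then have "2 * (int p + 1) dvd int p * ((int p ^ 2) ^ b - 1)" by simp
  also have "int p * ((int p ^ 2) ^ b - 1) = 2 ^ m - (int p + 1)"
  proof -
    have "int p ^ a + 1 = 2 ^ m" using arg_cong[OF assms(3), of int] by simp
    moreover have "int p ^ a = int p * (int p ^ 2) ^ b" using a by (simp add: power_mult)
    ultimately show ?thesis by (simp add: right_diff_distrib)
  qed
  finally have diff: "2 * (int p + 1) dvd 2 ^ m - (int p + 1)" .
  then have "int p + 1 dvd 2 ^ m - (int p + 1)" by (rule dvd_mult_right)
  then have "int p + 1 dvd (2 ^ m - (int p + 1)) + (int p + 1)" by (rule dvd_add) simp
  then have "int (p + 1) dvd int (2 ^ m)" by (simp add: add.commute)
  then have "p + 1 dvd 2 ^ m" by (simp only: of_nat_dvd_iff)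
  then obtain t where t: "t \<le> m" "p + 1 = 2 ^ t"
    by (auto simp: divides_primepow_nat[OF two_is_prime_nat])
  have "t = m"
  proof (rule ccontr)
    assume "t \<noteq> m"
    with t have "Suc t \<le> m" by simp
    then have "(2::int) ^ Suc t dvd 2 ^ m" by (rule le_imp_power_dvd)
    moreover have pt: "int p + 1 = 2 ^ t" using arg_cong[OF t(2), of int] by simp
    ultimately have "2 * (int p + 1) dvd 2 ^ m" by simp
    then have "2 * (int p + 1) dvd 2 ^ m - (2 ^ m - (int p + 1))" using diff by (rule dvd_diff)
    then have "2 * (int p + 1) dvd int p + 1" by simp
    then have "2 * (int p + 1) \<le> int p + 1" by (rule zdvd_imp_le) simp
    then show False by simp
  qed
  then show ?thesis using t(2) by simp
qed

section \<open>Divisors of the gcd\<close>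

lemma dvd_g2_iff:
  "d dvd g2 n \<longleftrightarrow> (\<forall>j. even j \<longrightarrow> 0 < j \<longrightarrow> j < 2 * n \<longrightarrow> d dvd (2 * n choose j))"
proof -
  have "{2 * n choose (2 * k) | k. 1 \<le> k \<and> k < n} =
      (\<lambda>j. 2 * n choose j) ` {j. even j \<and> 0 < j \<and> j < 2 * n}"
    by (fastforce elim!: evenE)
  then show ?thesis
    unfolding g2_def by (auto simp: dvd_Gcd_iff)
qed

lemma even_g2_power_2: "even (g2 (2 ^ i))"
  using prime_dvd_binomial_prime_power_multiple[OF two_is_prime_nat, of _ "Suc i" 1]
  by (simp add: dvd_g2_iff)

lemma not_4_dvd_g2_power_2:
  assumes "i > 0"
  shows "\<not> 4 dvd g2 (2 ^ i)"
proof
  assume "4 dvd g2 (2 ^ i)"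
  then have "4 dvd (2 * 2 ^ i choose 2 ^ i)"
    using assms by (simp add: dvd_g2_iff)
  moreover have "2 ^ i * (2 * 2 ^ i choose 2 ^ i) =
      2 * 2 ^ i * (2 * 2 ^ i - 1 choose (2 ^ i - 1 :: nat))"
    by (rule times_binomial_minus1_eq) simp
  then have "(2 * 2 ^ i choose 2 ^ i) = 2 * (2 * 2 ^ i - 1 choose (2 ^ i - 1 :: nat))"
    by simp
  ultimately have "even (2 * 2 ^ i - 1 choose (2 ^ i - 1 :: nat))"
    by presburger
  then show False
    using not_dvd_binomial_prime_power_multiple_minus_1[OF two_is_prime_nat, of 1 "2 ^ i - 1" "Suc i"]
    by (simp add: less_imp_diff_less)
qed

lemma odd_dvd_g2_power_2_imp_dvd_mersenne:
  assumes "i > 0" "odd d" "d dvd g2 (2 ^ i)"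
  shows "d dvd 2 ^ (i + 1) - 1"
proof -
  have "(1::nat) < 2 ^ i" using assms(1) by (intro one_less_power) simp_all
  then have "d dvd (2 * 2 ^ i choose 2)"
    using assms(3) by (simp add: dvd_g2_iff)
  moreover have "(2 * 2 ^ i choose 2 :: nat) = 2 ^ i * (2 ^ (i + 1) - 1)"
    by (simp add: choose_two)
  ultimately show ?thesis
    using assms(2) by (simp add: coprime_dvd_mult_right_iff)
qed

text \<open>
  If \<open>p ^ a\<close> is the exact power of \<open>p\<close> in \<open>2 ^ (i + 1) - 1\<close>, the even index \<open>p ^ a + 1\<close> must be
  the end of the row, for otherwise it would exhibit a coefficient that \<open>p\<close> does not divide.
\<close>

lemma odd_prime_dvd_g2_power_2:
  assumes "i > 0" "prime p" "odd p" "p dvd g2 (2 ^ i)"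
  shows "p = 2 ^ (i + 1) - 1"
proof -
  define M :: nat where "M = 2 ^ (i + 1) - 1"
  have M: "M + 1 = 2 * 2 ^ i" by (simp add: M_def)
  have "(1::nat) < 2 ^ (i + 1)" by (intro one_less_power) simp_all
  then have "M > 0" by (simp add: M_def)
  then obtain u where u: "M = p ^ multiplicity p M * u" "\<not> p dvd u"
    using assms(2) by (metis multiplicity_decompose' not_gr0 not_prime_unit)
  define a where "a = multiplicity p M"
  have "p dvd M"
    using odd_dvd_g2_power_2_imp_dvd_mersenne[OF assms(1,3,4)] by (simp add: M_def)
  then have a: "a > 0"
    using \<open>M > 0\<close> assms(2) by (simp add: a_def prime_multiplicity_gt_zero_iff)
  have eq: "M = p ^ a * u" using u by (simp add: a_def)
  have "\<not> p dvd (2 * 2 ^ i choose (p ^ a + 1))"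
    using not_dvd_binomial_multiple_plus_1[OF assms(2) a u(2)] eq M by metis
  moreover have "even (p ^ a + 1)" using assms(3) by simp
  ultimately have "\<not> p ^ a + 1 < 2 * 2 ^ i"
    using assms(4) unfolding dvd_g2_iff by (metis add_gr_0 zero_less_one)
  moreover have "p ^ a \<le> M" using eq \<open>M > 0\<close> by (simp add: dvd_imp_le)
  ultimately have "p ^ a + 1 = 2 ^ (i + 1)" using M by simp
  then show ?thesis
    using mersenne_prime_power[OF assms(3), of "i + 1" a] assms(1) by simp
qed

lemma mersenne_prime_dvd_g2:
  assumes "prime (2 ^ (i + 1) - 1 :: nat)"
  shows "2 ^ (i + 1) - 1 dvd g2 (2 ^ i)"
  unfolding dvd_g2_iff
proof (intro allI impI)
  fix j :: nat
  assume j: "even j" "0 < j" "j < 2 * 2 ^ i"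
  define M :: nat where "M = 2 ^ (i + 1) - 1"
  have M: "Suc M = 2 * 2 ^ i" by (simp add: M_def)
  then have "odd M" by (metis dvd_triv_left even_Suc)
  \<comment> \<open>Parity excludes the indices \<open>1\<close> and \<open>M\<close>, where the coefficient is \<open>M + 1\<close>.\<close>
  have "j \<noteq> M" "j \<noteq> 1" using j(1) \<open>odd M\<close> by auto
  then have "1 < j" "j < M" using j M by linarith+
  then show "2 ^ (i + 1) - 1 dvd (2 * 2 ^ i choose j)"
    using prime_dvd_binomial_Suc_prime[of M j] assms M by (simp add: M_def)
qed

section \<open>The equivalence\<close>

theorem theorem4:
  fixes i :: nat
  assumes "i > 0"
  shows "(g2 (2 ^ i) \<noteq> 2 \<longleftrightarrow> mersenne_exponent (i + 1)) \<and>
         (mersenne_exponent (i + 1) \<longleftrightarrow>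
            real (g2 (2 ^ i)) / 2 = 2 ^ (i + 1) - 1 \<and> mersenne_prime (2 ^ (i + 1) - 1))"
proof -
  define M :: nat where "M = 2 ^ (i + 1) - 1"
  have "(2::nat) \<le> 2 ^ i" using assms self_le_power[of "2::nat" i] by simp
  then have M: "M \<ge> 3" by (simp add: M_def)
  obtain h where h: "g2 (2 ^ i) = 2 * h" using even_g2_power_2[of i] by (elim evenE)
  have "odd h" using not_4_dvd_g2_power_2[OF assms] h by auto
  have "h dvd M"
    using odd_dvd_g2_power_2_imp_dvd_mersenne[OF assms \<open>odd h\<close>] h by (simp add: M_def)
  have prime_if: "prime M \<and> h = M" if "h \<noteq> 1"
  proof -
    obtain p where p: "prime p" "p dvd h" using prime_factor_nat \<open>h \<noteq> 1\<close> by blast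
    have "odd p" using p(2) \<open>odd h\<close> by (metis dvd_trans)
    then have "p = M"
      using odd_prime_dvd_g2_power_2[OF assms p(1)] p(2) h by (simp add: M_def)
    then show ?thesis using p \<open>h dvd M\<close> by (auto intro: dvd_antisym)
  qed
  have h_if: "h \<noteq> 1" if "prime M"
  proof
    assume "h = 1"
    then have "M dvd 2" using mersenne_prime_dvd_g2[of i] that h by (simp add: M_def)
    then show False using M by (auto dest: dvd_imp_le)
  qed
  have exponent: "mersenne_exponent (i + 1) \<longleftrightarrow> prime M"
    by (simp add: mersenne_exponent_def M_def)
  have mprime: "mersenne_prime (2 ^ (i + 1) - 1) \<longleftrightarrow> prime M"
    unfolding mersenne_prime_def M_def by blast
  have "real M = 2 ^ (i + 1) - 1" by (simp add: M_def of_nat_diff)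
  then have half: "real (g2 (2 ^ i)) / 2 = 2 ^ (i + 1) - 1 \<longleftrightarrow> h = M"
    using h by (metis nonzero_mult_div_cancel_left of_nat_eq_iff of_nat_mult of_nat_numeral
      zero_neq_numeral)
  have two: "g2 (2 ^ i) \<noteq> 2 \<longleftrightarrow> h \<noteq> 1" using h by simp
  show ?thesis
    unfolding exponent mprime half two using prime_if h_if by blast
qed

end
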